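(* If $G$ is a group in which some element $g \in G \setminus \{1_G\}$ has infinitely many roots, i.e. for infinitely many $n \in \mathbb{N}$ there exists $h \in G$ with $h^n = g$, then $G$ does not admit a midpointed convexoid.
   Context: A convexoid on $G$ is a family $\mathcal{C}$ of finite subsets of $G$ such that $\emptyset \in \mathcal{C}$, every finite subset of $G$ is contained in some element of $\mathcal{C}$, and whenever $C, D \in \mathcal{C}$ with $C \subsetneq D$ there is $a \in D \setminus C$ with $C \cup \{a\} \in \mathcal{C}$. For finite $B \subset G$ put $\overline{B} = \bigcap\{C \in \mathcal{C} : B \subset C\}$. The convexoid is midpointed if $g \in \overline{\{gh, gh^{-1}\}}$ for all $g,h \in G$. (No translation-invariance is assumed.) *)

theory Defs
  imports "HOL-Algebra.Group"
begin

definition convexoid :: "'a set \<Rightarrow> 'a set set \<Rightarrow> bool" where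
  "convexoid X \<C> \<longleftrightarrow>
     (\<forall>C\<in>\<C>. finite C \<and> C \<subseteq> X) \<and>
     {} \<in> \<C> \<and>
     (\<forall>F. finite F \<and> F \<subseteq> X \<longrightarrow> (\<exists>C\<in>\<C>. F \<subseteq> C)) \<and>
     (\<forall>C\<in>\<C>. \<forall>D\<in>\<C>. C \<subset> D \<longrightarrow> (\<exists>a\<in>D - C. insert a C \<in> \<C>))"

text \<open>For a convexoid the intersection below is over a nonempty family whenever
  \<open>B\<close> is a finite subset of the ground set; the family need not be closed under intersections,
  so the hull need not itself belong to \<open>\<C>\<close>.\<close>

definition hull_of :: "'a set set \<Rightarrow> 'a set \<Rightarrow> 'a set" where
  "hull_of \<C> B = \<Inter>{C \<in> \<C>. B \<subseteq> C}"

definition midpointed :: "('a, 'b) monoid_scheme \<Rightarrow> 'a set set \<Rightarrow> bool" where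
  "midpointed G \<C> \<longleftrightarrow>
     (\<forall>g\<in>carrier G. \<forall>h\<in>carrier G. g \<in> hull_of \<C> {g \<otimes>\<^bsub>G\<^esub> h, g \<otimes>\<^bsub>G\<^esub> inv\<^bsub>G\<^esub> h})"

end

theory Submission imports Defs
begin

text \<open>
  The proof rests on one observation about a midpointed convexoid \<open>\<C>\<close>. Members of \<open>\<C>\<close> can be
  enlarged one point at a time, so one may look at the moment just before a member swallows the
  last point \<open>a\<close> of a finite set \<open>P\<close>. At that moment \<open>P - {a}\<close> is already covered, and if \<open>a\<close> is
  the midpoint of two other points of \<open>P\<close>, midpointedness forces \<open>a\<close> to be covered too, which is
  absurd. Hence \<open>D \<in> \<C>\<close> contains every finite \<open>P\<close> in which each point outside \<open>D\<close> is the midpoint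
  of two other points of \<open>P\<close> (lemma \<open>convexoid_member_absorbs\<close>).

  With \<open>D = {}\<close> and \<open>P\<close> a finite cyclic group this shows that the group has no torsion. With
  \<open>P = {1, h, \<dots>, h\<^sup>n}\<close> it shows that a member containing \<open>1\<close> and \<open>g = h\<^sup>n\<close> contains all these
  powers, which are \<open>n + 1\<close> distinct points by torsion-freeness. A single finite member containing
  \<open>1\<close> and \<open>g\<close> therefore bounds all \<open>n\<close> for which \<open>g\<close> has an \<open>n\<close>-th root.
\<close>

context group
begin

text \<open>
  The condition \<open>h \<noteq> \<one>\<close> makes both \<open>a \<otimes> h\<close> and \<open>a \<otimes> inv h\<close> different from \<open>a\<close>, so that they are
  already present when \<open>a\<close> is the only missing point of \<open>P\<close>.
\<close>

lemma convexoid_member_absorbs: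
  assumes conv: "convexoid (carrier G) \<C>" and mid: "midpointed G \<C>"
    and D: "D \<in> \<C>" and P: "finite P" "P \<subseteq> carrier G"
    and midpoint: "\<And>a. a \<in> P - D \<Longrightarrow> \<exists>h\<in>carrier G. h \<noteq> \<one> \<and> a \<otimes> h \<in> P \<and> a \<otimes> inv h \<in> P"
  shows "P \<subseteq> D"
proof (rule ccontr)
  assume notsub: "\<not> P \<subseteq> D"
  have members: "\<forall>C\<in>\<C>. finite C \<and> C \<subseteq> carrier G"
    and cofinal: "\<forall>F. finite F \<and> F \<subseteq> carrier G \<longrightarrow> (\<exists>C\<in>\<C>. F \<subseteq> C)"
    and accessible: "\<forall>C\<in>\<C>. \<forall>D\<in>\<C>. C \<subset> D \<longrightarrow> (\<exists>a\<in>D - C. insert a C \<in> \<C>)"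
    using conv unfolding convexoid_def by - (elim conjE, assumption)+
  have "finite (D \<union> P)" "D \<union> P \<subseteq> carrier G"
    using members D P by auto
  then obtain E where E: "E \<in> \<C>" "D \<union> P \<subseteq> E"
    using cofinal by meson
  \<comment> \<open>A maximal member \<open>C\<close> between \<open>D\<close> and \<open>E\<close> that does not cover \<open>P\<close>: any one-point extension
    in \<open>\<C>\<close> inside \<open>E\<close> covers \<open>P\<close>, so exactly one point of \<open>P\<close> is missing from \<open>C\<close>.\<close>
  define S where "S = {C \<in> \<C>. D \<subseteq> C \<and> C \<subseteq> E \<and> \<not> P \<subseteq> C}"
  have "finite S"
    using members E(1) by (auto simp: S_def intro: finite_subset[of _ "Pow E"])
  moreover have "D \<in> S"
    using D E notsub by (auto simp: S_def)
  ultimately obtain C where C: "C \<in> S" and max: "\<And>C'. C' \<in> S \<Longrightarrow> C \<subseteq> C' \<Longrightarrow> C = C'"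
    by (metis empty_iff finite_has_maximal)
  then have "C \<in> \<C>" "C \<subset> E"
    using E by (auto simp: S_def)
  then obtain a where a: "a \<in> E - C" "insert a C \<in> \<C>"
    using accessible E(1) by meson
  have cover: "P \<subseteq> insert a C"
    using max[of "insert a C"] a C by (auto simp: S_def)
  then have "a \<in> P - D"
    using C a by (auto simp: S_def)
  then obtain h where h: "h \<in> carrier G" "h \<noteq> \<one>" "a \<otimes> h \<in> P" "a \<otimes> inv h \<in> P"
    using midpoint by blast
  have aG: "a \<in> carrier G"
    using \<open>a \<in> P - D\<close> P by auto
  have "a \<otimes> h \<noteq> a" "a \<otimes> inv h \<noteq> a"
    using aG h by (auto simp: inv_eq_1_iff)
  then have "a \<otimes> h \<in> C" "a \<otimes> inv h \<in> C"
    using cover h by auto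
  moreover have "a \<in> hull_of \<C> {a \<otimes> h, a \<otimes> inv h}"
    using mid aG h by (auto simp: midpointed_def)
  ultimately have "a \<in> C"
    using \<open>C \<in> \<C>\<close> by (auto simp: hull_of_def)
  then show False
    using a by simp
qed

text \<open>
  In a finite nontrivial cyclic group every point \<open>a\<close> is the midpoint of \<open>a \<otimes> g\<close> and
  \<open>a \<otimes> inv g\<close>, so the empty member would have to contain the group.
\<close>

lemma midpointed_convexoid_torsion_free:
  assumes "convexoid (carrier G) \<C>" and "midpointed G \<C>"
    and g: "g \<in> carrier G" "g \<noteq> \<one>" and m: "m > 0"
  shows "g [^] (m::nat) \<noteq> \<one>"
proof
  assume tor: "g [^] m = \<one>"
  let ?P = "range (\<lambda>i::nat. g [^] i)"
  have "g [^] i = g [^] (i mod m)" for i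
  proof -
    have "g [^] i = (g [^] m) [^] (i div m) \<otimes> g [^] (i mod m)"
      using g by (simp add: nat_pow_pow nat_pow_mult)
    then show ?thesis
      using g tor by simp
  qed
  then have "?P \<subseteq> (\<lambda>i. g [^] i) ` {..<m}"
    using m by (metis image_subsetI imageI lessThan_iff mod_less_divisor)
  then have "finite ?P"
    by (rule finite_subset) simp
  have inv_g: "inv g = g [^] (m - 1)"
  proof -
    have "g [^] (m - 1) \<otimes> g = \<one>"
      using tor m g by (simp flip: nat_pow_Suc)
    then show ?thesis
      using g by (simp add: inv_equality)
  qed
  have "?P \<subseteq> {}"
  proof (rule convexoid_member_absorbs)
    show "{} \<in> \<C>"
      using assms(1) by (simp add: convexoid_def)
    fix a assume "a \<in> ?P - {}"
    then obtain i :: nat where "a = g [^] i"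
      by auto
    then have "a \<otimes> g = g [^] Suc i" "a \<otimes> inv g = g [^] (i + (m - 1))"
      using g inv_g by (auto simp: nat_pow_mult)
    then show "\<exists>h\<in>carrier G. h \<noteq> \<one> \<and> a \<otimes> h \<in> ?P \<and> a \<otimes> inv h \<in> ?P"
      using g by (metis rangeI)
  qed (use assms \<open>finite ?P\<close> in auto)
  then show False
    by auto
qed

text \<open>
  The end points \<open>\<one>\<close> and \<open>h [^] n\<close> of the progression of powers of \<open>h\<close> lie in \<open>D\<close>, and every
  other term is the midpoint of its two neighbours.
\<close>

lemma convexoid_member_contains_powers:
  assumes "convexoid (carrier G) \<C>" and "midpointed G \<C>" and D: "D \<in> \<C>" "\<one> \<in> D"
    and h: "h \<in> carrier G" "h [^] (n::nat) \<in> D"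
  shows "(\<lambda>i::nat. h [^] i) ` {..n} \<subseteq> D" (is "?P \<subseteq> D")
proof (cases "h = \<one>")
  case False
  show ?thesis
  proof (rule convexoid_member_absorbs)
    fix a assume "a \<in> ?P - D"
    then obtain i where i: "a = h [^] i" "i \<le> n" "a \<notin> D"
      by auto
    have "i \<noteq> n" "i \<noteq> 0"
      using i D h by (auto intro: ccontr)
    then obtain j where j: "i = Suc j" "Suc i \<le> n"
      using i by (cases i) auto
    have "a \<otimes> h = h [^] Suc i" "a \<otimes> inv h = h [^] j"
      using i j h by (simp_all add: m_assoc)
    moreover have "Suc i \<in> {..n}" "j \<in> {..n}"
      using j by auto
    ultimately have "a \<otimes> h \<in> ?P" "a \<otimes> inv h \<in> ?P"
      by (metis imageI)+
    then show "\<exists>k\<in>carrier G. k \<noteq> \<one> \<and> a \<otimes> k \<in> ?P \<and> a \<otimes> inv k \<in> ?P"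
      using False h by blast
  qed (use assms in auto)
qed (use D in auto)

end

theorem proposition51:
  fixes G (structure)
  assumes "group G"
    and "g \<in> carrier G" and "g \<noteq> \<one>"
    and "infinite {n::nat. \<exists>h\<in>carrier G. h [^] n = g}"
  shows "\<not> (\<exists>\<C>. convexoid (carrier G) \<C> \<and> midpointed G \<C>)"
proof
  interpret group G by fact
  assume "\<exists>\<C>. convexoid (carrier G) \<C> \<and> midpointed G \<C>"
  then obtain \<C> where \<C>: "convexoid (carrier G) \<C>" "midpointed G \<C>"
    by blast
  have "finite {\<one>, g}" "{\<one>, g} \<subseteq> carrier G"
    using assms(2) by auto
  then obtain D where D: "D \<in> \<C>" "{\<one>, g} \<subseteq> D" and "finite D"
    using \<C>(1) unfolding convexoid_def by meson
  have "n < card D" if h: "h \<in> carrier G" "h [^] n = g" for h and n :: nat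
  proof -
    have "h \<noteq> \<one>"
      using h assms(3) by auto
    have "inj (\<lambda>i::nat. h [^] i)"
    proof (rule linorder_injI)
      fix i j :: nat assume "i < j"
      show "h [^] i \<noteq> h [^] j"
      proof
        assume "h [^] i = h [^] j"
        then have "h [^] (j - i) = \<one>"
          using h \<open>i < j\<close> pow_eq_div2[of h j i] by simp
        then show False
          using midpointed_convexoid_torsion_free[OF \<C> h(1) \<open>h \<noteq> \<one>\<close>, of "j - i"] \<open>i < j\<close> by simp
      qed
    qed
    then have "card ((\<lambda>i. h [^] i) ` {..n}) = Suc n"
      by (simp add: card_image inj_on_subset)
    moreover have "(\<lambda>i. h [^] i) ` {..n} \<subseteq> D"
      using convexoid_member_contains_powers[OF \<C> D(1)] D(2) h by auto
    ultimately show ?thesis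
      using card_mono[OF \<open>finite D\<close>] by (metis Suc_le_eq)
  qed
  then have "{n::nat. \<exists>h\<in>carrier G. h [^] n = g} \<subseteq> {..<card D}"
    by auto
  then show False
    using assms(4) finite_subset by blast
qed

end
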